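(* Let $k\geq 3$ be an odd integer, let $N\geq 1$, let $\chi$ be a quadratic Dirichlet character modulo $N$, and let $f(z)=q+\sum_{n\geq 2}a(n)q^n\in S_k^{new}(\Gamma_0(N),\chi)\cap\mathbb{Z}[[q]]$ be a normalized newform with trivial residual mod $2$ Galois representation. Then: 1. $a(p^{d-1})\neq \pm 1$ for every prime $p\nmid 2N$ and every integer $d\geq 2$. 2. For every integer $n>1$ with $\gcd(n,2N)=1$, $a(n)\neq\pm 1$. 3. If $n>1$ is an integer with $\gcd(n,2N)=1$ and $a(n)=\pm\ell$ for some odd prime $\ell$, then $n=p^{d-1}$ for some prime $p$ and some odd integer $d$ with $d\mid \ell(\ell^2-1)$. If moreover the value $\pm\ell=a(p^{d-1})=u_d(\alpha_p,\beta_p)$ is not defective, then $d$ is an odd prime.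
   Context: $q=e^{2\pi i z}$. The newform $f$ has trivial residual mod $2$ Galois representation if $a(p)$ is even for all primes $p\nmid 2N$. For a prime $p\nmid N$, $\alpha_p,\beta_p$ denote the roots of $x^2-a(p)x+\chi(p)p^{k-1}$, and one has $a(p^{n-1})=u_n(\alpha_p,\beta_p)$, where $u_n(\alpha,\beta)=\frac{\alpha^n-\beta^n}{\alpha-\beta}$. A Lucas pair $(\alpha,\beta)$ is a pair of algebraic integers, roots of a monic quadratic polynomial in $\mathbb{Z}[x]$, such that $\alpha+\beta$ and $\alpha\beta$ are coprime non-zero integers and $\alpha/\beta$ is not a root of unity; the numbers $u_n(\alpha,\beta)$ are its Lucas numbers. A prime $\ell\mid u_n(\alpha,\beta)$ is a primitive prime divisor of $u_n(\alpha,\beta)$ if $\ell\nmid(\alpha-\beta)^2u_1(\alpha,\beta)\cdots u_{n-1}(\alpha,\beta)$. A Lucas number $u_n(\alpha,\beta)$ with $n>2$ is called defective if it has no primitive prime divisor. The paper applies this terminology to the sequences $u_n(\alpha_p,\beta_p)$. *)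

theory Defs
  imports "HOL-Complex_Analysis.Complex_Analysis" "HOL-Computational_Algebra.Computational_Algebra"
begin

section \<open>Dirichlet characters\<close>

definition dirichlet_character :: "nat \<Rightarrow> (int \<Rightarrow> complex) \<Rightarrow> bool" where
  "dirichlet_character N chi \<longleftrightarrow>
     chi 1 = 1 \<and>
     (\<forall>m n. chi (m * n) = chi m * chi n) \<and>
     (\<forall>n. chi (n + int N) = chi n) \<and>
     (\<forall>n. chi n = 0 \<longleftrightarrow> \<not> coprime n (int N))"

text \<open>Quadratic means of exact order two.\<close>

definition quadratic_character :: "nat \<Rightarrow> (int \<Rightarrow> complex) \<Rightarrow> bool" where
  "quadratic_character N chi \<longleftrightarrow>
     dirichlet_character N chi \<and>
     (\<forall>n. coprime n (int N) \<longrightarrow> (chi n)\<^sup>2 = 1) \<and>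
     (\<exists>n. coprime n (int N) \<and> chi n \<noteq> 1)"

section \<open>Cusp forms with character\<close>

definition upper_half_plane :: "complex set" where
  "upper_half_plane = {z. Im z > 0}"

definition SL2Z :: "(int^2^2) set" where
  "SL2Z = {A. det A = 1}"

definition Gamma0 :: "nat \<Rightarrow> (int^2^2) set" where
  "Gamma0 N = {A \<in> SL2Z. int N dvd A $ 2 $ 1}"

definition cocycle :: "int^2^2 \<Rightarrow> complex \<Rightarrow> complex" where
  "cocycle A z = of_int (A $ 2 $ 1) * z + of_int (A $ 2 $ 2)"

definition moebius_act :: "int^2^2 \<Rightarrow> complex \<Rightarrow> complex" where
  "moebius_act A z = (of_int (A $ 1 $ 1) * z + of_int (A $ 1 $ 2)) / cocycle A z"

definition slash :: "nat \<Rightarrow> (complex \<Rightarrow> complex) \<Rightarrow> int^2^2 \<Rightarrow> complex \<Rightarrow> complex" where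
  "slash k f A z = f (moebius_act A z) / cocycle A z ^ k"

text \<open>Modular forms are represented by functions on all of \<open>\<complex>\<close>; every notion below only
  depends on their values on the upper half plane. The last clause is vanishing at all cusps:
  the functions \<open>slash k f A\<close>, for \<open>A\<close> in the full modular group, tend to \<open>0\<close> as
  \<open>Im z\<close> tends to infinity, uniformly in \<open>Re z\<close>.\<close>

definition cusp_forms :: "nat \<Rightarrow> nat \<Rightarrow> (int \<Rightarrow> complex) \<Rightarrow> (complex \<Rightarrow> complex) set" where
  "cusp_forms k N chi =
     {f. f holomorphic_on upper_half_plane \<and>
         (\<forall>A \<in> Gamma0 N. \<forall>z \<in> upper_half_plane.
            f (moebius_act A z) = chi (A $ 2 $ 2) * cocycle A z ^ k * f z) \<and>
         (\<forall>A \<in> SL2Z. (slash k f A \<longlongrightarrow> 0) (filtercomap Im at_top))}"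

definition has_q_expansion :: "(complex \<Rightarrow> complex) \<Rightarrow> (nat \<Rightarrow> complex) \<Rightarrow> bool" where
  "has_q_expansion f c \<longleftrightarrow>
     (\<forall>z \<in> upper_half_plane.
        (\<lambda>n. c n * exp (2 * of_real pi * \<i> * z) ^ n) sums f z)"

section \<open>The new subspace\<close>

definition fundamental_domain :: "complex set" where
  "fundamental_domain = {z \<in> upper_half_plane. \<bar>Re z\<bar> \<le> 1/2 \<and> cmod z \<ge> 1}"

text \<open>Representatives of the right cosets \<open>Gamma0 N ** A\<close> in the full modular group.\<close>

definition coset_representatives :: "nat \<Rightarrow> (int^2^2) set \<Rightarrow> bool" where
  "coset_representatives N R \<longleftrightarrow>
     R \<subseteq> SL2Z \<and> (\<forall>A \<in> SL2Z. \<exists>!B. B \<in> R \<and> (\<exists>G \<in> Gamma0 N. A = G ** B))"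

text \<open>The Petersson product on \<open>Gamma0 N\<close>: the integral of \<open>f(z) * cnj (g z) * (Im z)^k\<close>
  against \<open>dx dy / y\<^sup>2\<close> over the union of the translates of the standard fundamental domain.
  For forms with the same character the integrand is invariant under \<open>Gamma0 N\<close>, so the choice
  of representatives is immaterial. No volume normalisation is used.\<close>

definition petersson :: "nat \<Rightarrow> nat \<Rightarrow> (complex \<Rightarrow> complex) \<Rightarrow> (complex \<Rightarrow> complex) \<Rightarrow> complex" where
  "petersson k N f g =
     (\<Sum>B \<in> (SOME R. coset_representatives N R).
        LINT z:fundamental_domain|lborel.
          f (moebius_act B z) * cnj (g (moebius_act B z)) *
          of_real (Im (moebius_act B z) ^ k / (Im z)\<^sup>2))"

text \<open>The old subspace is spanned by the \<open>z \<mapsto> g (d * z)\<close> with \<open>g\<close> of proper divisor level \<open>M\<close>,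
  \<open>d\<close> dividing \<open>N / M\<close>, and \<open>\<psi>\<close> a character modulo \<open>M\<close> inducing \<open>chi\<close>.\<close>

inductive_set old_forms :: "nat \<Rightarrow> nat \<Rightarrow> (int \<Rightarrow> complex) \<Rightarrow> (complex \<Rightarrow> complex) set"
  for k N :: nat and chi :: "int \<Rightarrow> complex" where
  lift: "\<lbrakk>M dvd N; M < N; d dvd N div M; dirichlet_character M \<psi>;
          \<And>n. coprime n (int N) \<Longrightarrow> \<psi> n = chi n; g \<in> cusp_forms k M \<psi>\<rbrakk>
         \<Longrightarrow> (\<lambda>z. g (of_nat d * z)) \<in> old_forms k N chi"
| zero: "(\<lambda>z. 0) \<in> old_forms k N chi"
| add: "\<lbrakk>g \<in> old_forms k N chi; h \<in> old_forms k N chi\<rbrakk> \<Longrightarrow> (\<lambda>z. g z + h z) \<in> old_forms k N chi"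
| scale: "g \<in> old_forms k N chi \<Longrightarrow> (\<lambda>z. c * g z) \<in> old_forms k N chi"

definition new_forms :: "nat \<Rightarrow> nat \<Rightarrow> (int \<Rightarrow> complex) \<Rightarrow> (complex \<Rightarrow> complex) set" where
  "new_forms k N chi =
     {f \<in> cusp_forms k N chi. \<forall>g \<in> old_forms k N chi. petersson k N f g = 0}"

section \<open>Hecke operators and newforms\<close>

text \<open>\<open>T\<^sub>m f (z) = m^(k-1) \<Sum>_(e d = m) chi(e) d^(-k) \<Sum>_(b < d) f ((e z + b) / d)\<close>; for primes
  dividing \<open>N\<close> this is the operator usually called \<open>U\<^sub>p\<close>, since then \<open>chi(p) = 0\<close>.\<close>

definition hecke_operator ::
  "nat \<Rightarrow> (int \<Rightarrow> complex) \<Rightarrow> nat \<Rightarrow> (complex \<Rightarrow> complex) \<Rightarrow> complex \<Rightarrow> complex" where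
  "hecke_operator k chi m f z =
     of_nat m ^ (k - 1) *
     (\<Sum>d | d dvd m. \<Sum>b<d.
        chi (int (m div d)) / of_nat d ^ k * f ((of_nat (m div d) * z + of_nat b) / of_nat d))"

definition newform :: "nat \<Rightarrow> nat \<Rightarrow> (int \<Rightarrow> complex) \<Rightarrow> (complex \<Rightarrow> complex) \<Rightarrow> bool" where
  "newform k N chi f \<longleftrightarrow>
     f \<in> new_forms k N chi \<and>
     (\<exists>c. has_q_expansion f c \<and> c 1 = 1) \<and>
     (\<forall>m\<ge>1. \<exists>ev. \<forall>z \<in> upper_half_plane. hecke_operator k chi m f z = ev * f z)"

definition trivial_residual_mod2 :: "nat \<Rightarrow> (nat \<Rightarrow> int) \<Rightarrow> bool" where
  "trivial_residual_mod2 N a \<longleftrightarrow> (\<forall>p. prime p \<and> \<not> p dvd 2 * N \<longrightarrow> even (a p))"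

section \<open>Lucas numbers\<close>

definition frobenius_roots ::
  "nat \<Rightarrow> (int \<Rightarrow> complex) \<Rightarrow> (nat \<Rightarrow> int) \<Rightarrow> nat \<Rightarrow> complex \<Rightarrow> complex \<Rightarrow> bool" where
  "frobenius_roots k chi a p \<alpha> \<beta> \<longleftrightarrow>
     [:chi (int p) * of_nat p ^ (k - 1), - of_int (a p), 1:] = [:- \<alpha>, 1:] * [:- \<beta>, 1:]"

text \<open>For \<open>\<alpha> = \<beta>\<close> the quotient is read as its polynomial value.\<close>

definition lucas_number :: "complex \<Rightarrow> complex \<Rightarrow> nat \<Rightarrow> complex" where
  "lucas_number \<alpha> \<beta> n =
     (if \<alpha> = \<beta> then of_nat n * \<alpha> ^ (n - 1) else (\<alpha> ^ n - \<beta> ^ n) / (\<alpha> - \<beta>))"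

text \<open>Divisibility of rational integers, both sides being viewed in \<open>\<complex>\<close>.\<close>

definition int_dvd :: "nat \<Rightarrow> complex \<Rightarrow> bool" where
  "int_dvd l x \<longleftrightarrow> (\<exists>m::int. x = of_nat l * of_int m)"

definition primitive_prime_divisor :: "complex \<Rightarrow> complex \<Rightarrow> nat \<Rightarrow> nat \<Rightarrow> bool" where
  "primitive_prime_divisor \<alpha> \<beta> n l \<longleftrightarrow>
     prime l \<and> int_dvd l (lucas_number \<alpha> \<beta> n) \<and>
     \<not> int_dvd l ((\<alpha> - \<beta>)\<^sup>2 * (\<Prod>i=1..<n. lucas_number \<alpha> \<beta> i))"

text \<open>The pair is not required to be a Lucas pair, as the notion is applied to the Frobenius roots
  at an arbitrary good prime, where coprimality of sum and product may fail.\<close>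

definition defective :: "complex \<Rightarrow> complex \<Rightarrow> nat \<Rightarrow> bool" where
  "defective \<alpha> \<beta> n \<longleftrightarrow> n > 2 \<and> \<not> (\<exists>l. primitive_prime_divisor \<alpha> \<beta> n l)"

end

theory Submission
  imports Defs "HOL-Number_Theory.Residues"
begin

text \<open>For a prime \<open>p\<close> not dividing \<open>N\<close>, comparing coefficients in \<open>T\<^sub>p f = a(p) f\<close> gives
  \<open>a (p ^ e * m) = u\<^sub>e\<^sub>+\<^sub>1 a m\<close> for \<open>m\<close> prime to \<open>p\<close>, where \<open>u\<close> is the Lucas sequence with parameters
  \<open>P = a(p)\<close> and \<open>Q = \<chi>(p) p\<^sup>k\<^sup>-\<^sup>1\<close>. Since \<open>k\<close> is odd, \<open>Q = \<plusminus>s\<^sup>2\<close> with \<open>s > 1\<close>, and \<open>P\<close> is even. This makes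
  the classification of defective Lucas numbers unnecessary: \<open>u\<^sub>n\<close> is even for even \<open>n\<close>, while
  \<open>u\<^sub>2\<^sub>j\<^sub>+\<^sub>1 = u\<^sub>j\<^sub>+\<^sub>1\<^sup>2 - Q u\<^sub>j\<^sup>2\<close> is a difference of squares or a sum of squares, and can only be a unit if
  \<open>u\<^sub>j = 0\<close>, which contradicts \<open>u\<^sub>j\<^sub>+\<^sub>1\<^sup>2 - P u\<^sub>j\<^sub>+\<^sub>1 u\<^sub>j + Q u\<^sub>j\<^sup>2 = Q\<^sup>j\<close>. The pair \<open>(\<alpha>\<^sup>b, \<beta>\<^sup>b)\<close> satisfies the same
  hypotheses as \<open>(\<alpha>, \<beta>)\<close>, so \<open>u\<^sub>b\<^sub>c(\<alpha>, \<beta>) = u\<^sub>b(\<alpha>, \<beta>) u\<^sub>c(\<alpha>\<^sup>b, \<beta>\<^sup>b)\<close> is a product of two non-units, and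
  \<open>u\<^sub>n\<close> can be a prime up to sign only for prime \<open>n\<close>, defective or not. Then \<open>n\<close> is the rank of
  apparition of \<open>l\<close>, hence divides \<open>l\<close>, \<open>l - 1\<close> or \<open>l + 1\<close>; the case \<open>l = p\<close> is excluded
  because then \<open>l\<close> divides \<open>P\<close> and \<open>l\<^sup>n\<^sup>-\<^sup>1\<close> divides \<open>u\<^sub>n\<close>.\<close>

section \<open>Lucas sequences\<close>

fun lucas_U :: "int \<Rightarrow> int \<Rightarrow> nat \<Rightarrow> int" where
  "lucas_U P Q 0 = 0"
| "lucas_U P Q (Suc 0) = 1"
| "lucas_U P Q (Suc (Suc n)) = P * lucas_U P Q (Suc n) - Q * lucas_U P Q n"

text \<open>The companion sequence \<open>\<alpha> ^ n + \<beta> ^ n\<close>, see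
  \<open>lucas_V_binet\<close>; in this form it is visibly even for even \<open>P\<close>.\<close>

definition lucas_V :: "int \<Rightarrow> int \<Rightarrow> nat \<Rightarrow> int" where
  "lucas_V P Q n = 2 * lucas_U P Q (Suc n) - P * lucas_U P Q n"

lemma lucas_V_simps [simp]:
  "lucas_V P Q 0 = 2"
  "lucas_V P Q (Suc 0) = P"
  "lucas_V P Q (Suc (Suc n)) = P * lucas_V P Q (Suc n) - Q * lucas_V P Q n"
  by (simp_all add: lucas_V_def algebra_simps)

text \<open>Both sides obey the same second-order recurrence in \<open>m\<close>.\<close>

lemma lucas_U_add:
  "lucas_U P Q (Suc (m + n)) =
     lucas_U P Q (Suc m) * lucas_U P Q (Suc n) - Q * lucas_U P Q m * lucas_U P Q n"
proof (induction m rule: induct_nat_012)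
  case (ge2 m)
  have "lucas_U P Q (Suc (Suc (Suc m) + n)) =
      P * lucas_U P Q (Suc (Suc m + n)) - Q * lucas_U P Q (Suc (m + n))"
    by simp
  also have "\<dots> = lucas_U P Q (Suc (Suc (Suc m))) * lucas_U P Q (Suc n)
      - Q * lucas_U P Q (Suc (Suc m)) * lucas_U P Q n"
    unfolding ge2 by (simp add: algebra_simps)
  finally show ?case .
qed simp_all

text \<open>The left side is the norm of U_(n+1) - \<beta> U_n, which equals
  \<open>\<alpha> ^ n\<close>.\<close>

lemma lucas_U_cassini:
  "(lucas_U P Q (Suc n))\<^sup>2 - P * lucas_U P Q (Suc n) * lucas_U P Q n + Q * (lucas_U P Q n)\<^sup>2 = Q ^ n"
proof (induction n)
  case (Suc n)
  have "Q ^ Suc n = Q * ((lucas_U P Q (Suc n))\<^sup>2 - P * lucas_U P Q (Suc n) * lucas_U P Q n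
      + Q * (lucas_U P Q n)\<^sup>2)"
    using Suc by simp
  then show ?case
    by (simp add: power2_eq_square algebra_simps)
qed simp

text \<open>Along a progression of step \<open>m\<close>, U obeys the recurrence whose parameters
  are the sum \<open>lucas_V P Q m\<close> and the product \<open>Q ^ m\<close> of
  \<open>\<alpha> ^ m\<close> and \<open>\<beta> ^ m\<close>.\<close>

lemma lucas_U_shift:
  "lucas_U P Q (n + 2 * m) = lucas_V P Q m * lucas_U P Q (n + m) - Q ^ m * lucas_U P Q n"
proof (induction n rule: induct_nat_012)
  case 0
  show ?case
  proof (cases m)
    case (Suc j)
    have "lucas_U P Q (2 * m) = lucas_U P Q (Suc (j + m))"
      by (simp only: Suc mult_2 add_Suc)
    also have "\<dots> = lucas_U P Q m * lucas_U P Q (Suc m) - Q * lucas_U P Q j * lucas_U P Q m"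
      by (simp only: lucas_U_add Suc)
    finally show ?thesis
      by (simp add: lucas_V_def Suc algebra_simps)
  qed simp
next
  case 1
  have "lucas_U P Q (Suc 0 + 2 * m) = lucas_U P Q (Suc (m + m))"
    by (simp only: mult_2 add_Suc add_0)
  also have "\<dots> = (lucas_U P Q (Suc m))\<^sup>2 - Q * (lucas_U P Q m)\<^sup>2"
    by (simp only: lucas_U_add power2_eq_square mult.assoc)
  also have "\<dots> = lucas_V P Q m * lucas_U P Q (Suc m) - Q ^ m"
    unfolding lucas_U_cassini[of P Q m, symmetric] lucas_V_def
    by (simp add: power2_eq_square algebra_simps)
  finally show ?case
    by simp
next
  case (ge2 n)
  have "lucas_U P Q (Suc (Suc n) + 2 * m) = P * lucas_U P Q (Suc n + 2 * m) - Q * lucas_U P Q (n + 2 * m)"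
    by simp
  also have "\<dots> = lucas_V P Q m * lucas_U P Q (Suc (Suc n) + m) - Q ^ m * lucas_U P Q (Suc (Suc n))"
    unfolding ge2 by (simp add: algebra_simps)
  finally show ?case .
qed

text \<open>The multiples of \<open>m\<close> form such a progression, with initial values 0 and
  \<open>lucas_U P Q m\<close>.\<close>

lemma lucas_U_mult:
  "lucas_U P Q (m * n) = lucas_U P Q m * lucas_U (lucas_V P Q m) (Q ^ m) n"
proof (induction n rule: induct_nat_012)
  case (ge2 n)
  have "lucas_U P Q (m * Suc (Suc n)) = lucas_U P Q (m * n + 2 * m)"
    by (simp only: mult_Suc_right mult_2 add_ac)
  also have "\<dots> = lucas_V P Q m * lucas_U P Q (m * Suc n) - Q ^ m * lucas_U P Q (m * n)"
    by (simp only: lucas_U_shift mult_Suc_right add.commute)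
  also have "\<dots> = lucas_U P Q m * lucas_U (lucas_V P Q m) (Q ^ m) (Suc (Suc n))"
    unfolding ge2 by (simp add: algebra_simps)
  finally show ?case .
qed simp_all

section \<open>Parity, unit values and prime values of U\<close>

lemma even_lucas_V: "even P \<Longrightarrow> even (lucas_V P Q n)"
  by (simp add: lucas_V_def)

lemma even_lucas_U: "even P \<Longrightarrow> even n \<Longrightarrow> even (lucas_U P Q n)"
  by (induction n rule: induct_nat_012) auto

lemma abs_lucas_U_ne_1:
  assumes "even P" and Q: "\<bar>Q\<bar> = s\<^sup>2" and s: "s > 1" and n: "n \<ge> 2"
  shows "\<bar>lucas_U P Q n\<bar> \<noteq> 1"
proof
  assume unit: "\<bar>lucas_U P Q n\<bar> = 1"
  have "odd n"
  proof
    assume "even n"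
    then have "even \<bar>lucas_U P Q n\<bar>"
      using even_lucas_U[OF \<open>even P\<close>] by simp
    then show False
      by (simp only: unit odd_one)
  qed
  then obtain j where j: "n = 2 * j + 1"
    by (elim oddE)
  define x where "x = lucas_U P Q (Suc j)"
  define y where "y = lucas_U P Q j"
  have eq: "lucas_U P Q n = x\<^sup>2 - Q * y\<^sup>2"
    using lucas_U_add[of P Q j j] by (simp add: j x_def y_def power2_eq_square mult_2)
  have "y = 0 \<and> \<bar>x\<bar> = 1"
  proof (cases "Q \<ge> 0")
    case True
    then have "Q = s\<^sup>2"
      using Q by simp
    then have "\<bar>x - s * y\<bar> * \<bar>x + s * y\<bar> = 1"
      using eq unit by (simp flip: abs_mult add: power2_eq_square algebra_simps)
    then have "\<bar>x - s * y\<bar> = 1" "\<bar>x + s * y\<bar> = 1"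
      using zmult_eq_1_iff by auto
    \<comment> \<open>Two integer units are equal or opposite, so one of \<open>x\<close> and
      \<open>s * y\<close> vanishes and the other is a unit.\<close>
    then have "(x = 0 \<and> \<bar>s * y\<bar> = 1) \<or> (\<bar>x\<bar> = 1 \<and> s * y = 0)"
      by linarith
    moreover have "\<bar>s * y\<bar> \<noteq> 1"
      using s by (auto simp: abs_mult zmult_eq_1_iff)
    ultimately show ?thesis
      using s by auto
  next
    case False
    then have "Q = - s\<^sup>2"
      using Q by simp
    then have *: "x\<^sup>2 + s\<^sup>2 * y\<^sup>2 = 1"
      using eq unit by simp
    have "y = 0"
    proof (rule ccontr)
      assume "y \<noteq> 0"
      then have "y\<^sup>2 \<ge> 1"
        by (simp add: int_one_le_iff_zero_less)
      moreover have "s\<^sup>2 > 1"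
        using s by (simp add: one_less_power)
      ultimately have "s\<^sup>2 * y\<^sup>2 > 1 * 1"
        by (intro mult_less_le_imp_less) auto
      then show False
        using * zero_le_power2[of x] by linarith
    qed
    then show ?thesis
      using * by (auto simp: power2_eq_1_iff)
  qed
  \<comment> \<open>With \<open>y = 0\<close> the Cassini identity reduces to
    \<open>Q ^ j = x\<^sup>2 = 1\<close>; below, \<open>j > 0\<close> comes from
    \<open>n \<ge> 2\<close>.\<close>
  then have "\<bar>Q ^ j\<bar> = 1"
    using lucas_U_cassini[of P Q j]
    by (simp add: x_def y_def flip: power2_abs[of "lucas_U P Q (Suc j)"])
  moreover have "\<bar>Q\<bar> > 1" "j > 0"
    using Q s n j by (auto simp: one_less_power)
  ultimately show False
    by (metis one_less_power power_abs less_irrefl)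
qed

lemma prime_index_lucas_U:
  assumes P: "even P" and Q: "\<bar>Q\<bar> = s\<^sup>2" and s: "s > 1" and pr: "prime \<bar>lucas_U P Q n\<bar>"
  shows "prime n"
proof (rule ccontr)
  assume "\<not> prime n"
  moreover have "n \<noteq> 0" "n \<noteq> 1"
    using pr by (auto intro!: Nat.gr0I)
  ultimately obtain b where b: "b dvd n" "b \<noteq> 1" "b \<noteq> n"
    by (auto simp: prime_nat_iff)
  then obtain c where c: "n = b * c"
    by blast
  have "b \<noteq> 0" "c \<noteq> 0" "c \<noteq> 1"
    using c b \<open>n \<noteq> 0\<close> by auto
  then have bc: "b \<ge> 2" "c \<ge> 2"
    using b by linarith+
  \<comment> \<open>For the roots \<open>\<alpha> ^ b\<close>, \<open>\<beta> ^ b\<close> the square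
    root of the absolute product is \<open>s ^ b\<close>, so \<open>abs_lucas_U_ne_1\<close> applies
    to the second factor of \<open>lucas_U_mult\<close>.\<close>
  have "\<bar>Q ^ b\<bar> = (s ^ b)\<^sup>2"
    using Q by (simp add: power_abs flip: power_mult) (simp add: mult.commute power_mult)
  moreover have "s ^ b > 1"
    using s bc by (simp add: one_less_power)
  ultimately have "\<bar>lucas_U (lucas_V P Q b) (Q ^ b) c\<bar> \<noteq> 1"
    using abs_lucas_U_ne_1 even_lucas_V[OF P] bc by blast
  moreover have "\<bar>lucas_U P Q b\<bar> \<noteq> 1"
    using abs_lucas_U_ne_1[OF P Q s] bc by blast
  moreover have "\<bar>lucas_U P Q b\<bar> * \<bar>lucas_U (lucas_V P Q b) (Q ^ b) c\<bar> = \<bar>lucas_U P Q n\<bar>"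
    by (simp add: c lucas_U_mult abs_mult)
  ultimately show False
    using irreducibleD[OF prime_elem_imp_irreducible[OF prime_imp_prime_elem[OF pr]]]
    by (metis abs_abs zdvd1_eq)
qed

section \<open>Congruences modulo primes and the rank of apparition\<close>

text \<open>Modulo \<open>Q\<close> the recurrence is geometric. Hence a prime dividing
  \<open>Q\<close> and a term U_(n+1) also divides \<open>P\<close>.\<close>

lemma lucas_U_cong_power: "[lucas_U P Q (Suc n) = P ^ n] (mod Q)"
proof (induction n)
  case (Suc n)
  then have "[P * lucas_U P Q (Suc n) - Q * lucas_U P Q n = P * P ^ n - 0] (mod Q)"
    by (intro cong_diff cong_mult) (auto simp: cong_0_iff)
  then show ?case
    by simp
qed simp

text \<open>U_(n+1) is homogeneous of weight \<open>n\<close> when \<open>P\<close> has weight 1 and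
  \<open>Q\<close> has weight 2.\<close>

lemma power_dvd_lucas_U:
  assumes "r dvd P" "r\<^sup>2 dvd Q"
  shows "r ^ n dvd lucas_U P Q (Suc n)"
proof (induction n rule: induct_nat_012)
  case (ge2 n)
  have "r ^ Suc (Suc n) dvd P * lucas_U P Q (Suc (Suc n))"
    using mult_dvd_mono[OF assms(1) ge2(2)] by simp
  moreover have "r ^ Suc (Suc n) dvd Q * lucas_U P Q (Suc n)"
    using mult_dvd_mono[OF assms(2) ge2(1)] by (simp add: power2_eq_square mult.assoc)
  ultimately show ?case
    by (simp only: lucas_U.simps dvd_diff)
qed (use assms in auto)

lemma lucas_V_binet:
  assumes "\<alpha> + \<beta> = of_int P" "\<alpha> * \<beta> = of_int Q"
  shows "(of_int (lucas_V P Q n) :: complex) = \<alpha> ^ n + \<beta> ^ n"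
  by (induction n rule: induct_nat_012) (simp_all add: assms [symmetric] algebra_simps)

lemma lucas_roots_exist:
  fixes P Q :: int
  obtains \<alpha> \<beta> :: complex where "\<alpha> + \<beta> = of_int P" "\<alpha> * \<beta> = of_int Q"
proof -
  define r where "r = csqrt (of_int (P\<^sup>2 - 4 * Q))"
  have "r\<^sup>2 = of_int (P\<^sup>2 - 4 * Q)"
    by (simp add: r_def)
  then show ?thesis
    by (intro that[of "(of_int P + r) / 2" "(of_int P - r) / 2"])
       (simp_all add: field_simps power2_eq_square)
qed

lemma fermat_int:
  assumes "prime l"
  shows "[P ^ l = P] (mod int l)"
proof (cases "int l dvd P")
  case True
  have l: "l > 0"
    using assms by (simp add: prime_gt_0_nat)
  then show ?thesis
    using True by (simp add: cong_def mod_eq_0_iff_dvd dvd_power_same dvd_trans[OF _ dvd_power])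
next
  case False
  have l: "l > 0"
    using assms by (simp add: prime_gt_0_nat)
  have "\<not> l dvd nat (P mod int l)"
    using False l by (simp add: dvd_mod_iff flip: int_dvd_int_iff)
  then have "[nat (P mod int l) ^ (l - 1) = 1] (mod l)"
    by (intro fermat_theorem assms)
  then have "[(P mod int l) ^ (l - 1) = 1] (mod int l)"
    using l by (simp flip: cong_int_iff)
  then have "[P ^ (l - 1) = 1] (mod int l)"
    by (simp add: cong_def power_mod)
  then have "[P * P ^ (l - 1) = P * 1] (mod int l)"
    by (rule cong_scalar_left)
  then show ?thesis
    using l by (simp flip: power_Suc)
qed

text \<open>Frobenius on \<open>(\<alpha> + \<beta>) ^ l\<close>, the binomial sum being symmetrised so that all its
  terms are integers.\<close>

lemma lucas_V_prime_cong:
  assumes "prime l" "odd l"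
  shows "[lucas_V P Q l = P] (mod int l)"
proof -
  obtain \<alpha> \<beta> :: complex where ab: "\<alpha> + \<beta> = of_int P" "\<alpha> * \<beta> = of_int Q"
    by (rule lucas_roots_exist)
  \<comment> \<open>Taking out the common power of \<open>\<alpha> * \<beta> = Q\<close> from the
    two mirrored terms leaves a value of V at the difference of the exponents.\<close>
  define W where "W i = Q ^ min i (l - i) * lucas_V P Q (max i (l - i) - min i (l - i))" for i
  have W: "of_int (W i) = \<alpha> ^ i * \<beta> ^ (l - i) + \<beta> ^ i * \<alpha> ^ (l - i)" if "i \<le> l" for i
  proof (cases "i \<le> l - i")
    case True
    have "\<alpha> ^ (l - i) = \<alpha> ^ i * \<alpha> ^ (l - i - i)" "\<beta> ^ (l - i) = \<beta> ^ i * \<beta> ^ (l - i - i)"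
      using True by (simp_all flip: power_add)
    with True show ?thesis
      by (simp add: W_def lucas_V_binet[OF ab] ab(2) [symmetric] power_mult_distrib algebra_simps)
  next
    case False
    have "\<alpha> ^ i = \<alpha> ^ (l - i) * \<alpha> ^ (i - (l - i))" "\<beta> ^ i = \<beta> ^ (l - i) * \<beta> ^ (i - (l - i))"
      using False by (simp_all flip: power_add)
    with False show ?thesis
      by (simp add: W_def lucas_V_binet[OF ab] ab(2) [symmetric] power_mult_distrib algebra_simps)
  qed
  have "of_int (2 * P ^ l) = (\<alpha> + \<beta>) ^ l + (\<beta> + \<alpha>) ^ l"
    using ab by (simp add: add.commute)
  also have "\<dots> = (\<Sum>i\<le>l. of_nat (l choose i) * of_int (W i))"
    by (subst (1 2) binomial_ring) (simp add: W algebra_simps sum.distrib)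
  finally have "(of_int (2 * P ^ l) :: complex) = of_int (\<Sum>i\<le>l. int (l choose i) * W i)"
    by simp
  then have eq: "2 * P ^ l = (\<Sum>i\<le>l. int (l choose i) * W i)"
    by (simp only: of_int_eq_iff)
  have l: "l > 0"
    using assms by (simp add: prime_gt_0_nat)
  \<comment> \<open>The end terms \<open>i = 0\<close> and \<open>i = l\<close> both equal V_l; the
    other binomials are divisible by \<open>l\<close>, and the factor 2 cancels since
    \<open>l\<close> is odd.\<close>
  have "{..l} = insert 0 (insert l {1..<l})"
    using l by auto
  then have "(\<Sum>i\<le>l. int (l choose i) * W i) = 2 * lucas_V P Q l + (\<Sum>i=1..<l. int (l choose i) * W i)"
    using l by (simp add: W_def)
  moreover have "int l dvd (\<Sum>i=1..<l. int (l choose i) * W i)"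
    using assms by (intro dvd_sum dvd_mult2) (auto intro!: dvd_choose_prime)
  ultimately have "int l dvd 2 * P ^ l - 2 * lucas_V P Q l"
    using eq by simp
  then have "int l dvd 2 * (P ^ l - lucas_V P Q l)"
    by (simp only: right_diff_distrib)
  moreover have "coprime (int l) 2"
    using assms by simp
  ultimately have "int l dvd P ^ l - lucas_V P Q l"
    by (metis coprime_dvd_mult_right_iff)
  then have "[P ^ l = lucas_V P Q l] (mod int l)"
    by (simp add: cong_iff_dvd_diff)
  moreover have "[P ^ l = P] (mod int l)"
    by (rule fermat_int[OF assms(1)])
  ultimately show ?thesis
    by (metis cong_sym cong_trans)
qed

text \<open>When \<open>m\<close> divides the discriminant, both roots are P/2 modulo
  \<open>m\<close> and U_(n+1) becomes (n+1) (P/2)^n; the powers of 2 clear denominators.\<close>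

lemma lucas_U_index_cong:
  assumes "4 * Q = P\<^sup>2 + m * c"
  shows "[2 ^ n * lucas_U P Q (Suc n) = int (Suc n) * P ^ n] (mod m)"
proof (induction n rule: induct_nat_012)
  case (ge2 n)
  have "[2 * P * (2 ^ Suc n * lucas_U P Q (Suc (Suc n))) - 4 * Q * (2 ^ n * lucas_U P Q (Suc n))
      = 2 * P * (int (Suc (Suc n)) * P ^ Suc n) - P\<^sup>2 * (int (Suc n) * P ^ n)] (mod m)"
  proof (rule cong_diff)
    show "[2 * P * (2 ^ Suc n * lucas_U P Q (Suc (Suc n))) = 2 * P * (int (Suc (Suc n)) * P ^ Suc n)] (mod m)"
      by (rule cong_scalar_left) (rule ge2)
    have "[4 * Q = P\<^sup>2] (mod m)"
      by (simp add: assms cong_iff_dvd_diff)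
    then show "[4 * Q * (2 ^ n * lucas_U P Q (Suc n)) = P\<^sup>2 * (int (Suc n) * P ^ n)] (mod m)"
      by (rule cong_mult) (rule ge2)
  qed
  then show ?case
    by (simp add: algebra_simps power2_eq_square)
qed simp_all

text \<open>The first case is a discriminant divisible by \<open>l\<close>. Otherwise U_l^2 = 1 and
  V_l^2 = P^2 modulo \<open>l\<close>, which avoids Legendre symbols by treating the indices
  \<open>l - 1\<close> and \<open>l + 1\<close> together.\<close>

lemma prime_dvd_lucas_U_index:
  assumes l: "prime l" "odd l"
  shows "int l dvd lucas_U P Q l \<or> int l dvd Q * lucas_U P Q (l - 1) * lucas_U P Q (Suc l)"
proof (cases "int l dvd P\<^sup>2 - 4 * Q")
  case True
  then obtain c where "P\<^sup>2 - 4 * Q = int l * c"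
    by blast
  then have "4 * Q = P\<^sup>2 + int l * (- c)"
    by simp
  then have "[2 ^ (l - 1) * lucas_U P Q (Suc (l - 1)) = int (Suc (l - 1)) * P ^ (l - 1)] (mod int l)"
    by (rule lucas_U_index_cong)
  then have "int l dvd 2 ^ (l - 1) * lucas_U P Q l"
    using l by (simp add: prime_gt_0_nat cong_dvd_iff)
  moreover have "coprime (int l) (2 ^ (l - 1))"
    using l by simp
  ultimately show ?thesis
    by (metis coprime_dvd_mult_right_iff)
next
  case False
  define U V where "U = lucas_U P Q l" and "V = lucas_V P Q l"
  have pr: "prime (int l)"
    using l by simp
  obtain j where j: "l = Suc j"
    using l by (cases l) auto
  have VP: "[V\<^sup>2 = P\<^sup>2] (mod int l)"
    using lucas_V_prime_cong[OF l] by (simp add: V_def cong_pow)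
  have Ql: "[Q ^ l = Q] (mod int l)"
    by (rule fermat_int[OF l(1)])
  \<comment> \<open>The Cassini identity in terms of U_l and V_l. Modulo \<open>l\<close> the right
    side is again the discriminant, which then cancels.\<close>
  have eq: "(P\<^sup>2 - 4 * Q) * U\<^sup>2 = V\<^sup>2 - 4 * Q ^ l"
    using lucas_U_cassini[of P Q l] by (simp add: U_def V_def lucas_V_def power2_eq_square algebra_simps)
  have "[(P\<^sup>2 - 4 * Q) * U\<^sup>2 = P\<^sup>2 - 4 * Q] (mod int l)"
    unfolding eq by (intro cong_diff VP cong_scalar_left Ql)
  then have "int l dvd (P\<^sup>2 - 4 * Q) * (U\<^sup>2 - 1)"
    by (simp add: cong_iff_dvd_diff algebra_simps)
  then have "int l dvd U\<^sup>2 - 1"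
    using False pr by (simp add: prime_dvd_mult_iff)
  then have "[P\<^sup>2 * U\<^sup>2 = P\<^sup>2 * 1] (mod int l)"
    by (intro cong_scalar_left) (simp add: cong_iff_dvd_diff)
  then have "int l dvd P\<^sup>2 * U\<^sup>2 - V\<^sup>2"
    using VP by (metis cong_iff_dvd_diff cong_sym cong_trans mult.right_neutral)
  \<comment> \<open>P U_l and V_l are the sum and the difference of U_(l+1) and Q U_(l-1).\<close>
  moreover have "4 * (Q * lucas_U P Q (l - 1) * lucas_U P Q (Suc l)) = P\<^sup>2 * U\<^sup>2 - V\<^sup>2"
    by (simp add: U_def V_def lucas_V_def j power2_eq_square algebra_simps)
  ultimately have "int l dvd 2 ^ 2 * (Q * lucas_U P Q (l - 1) * lucas_U P Q (Suc l))"
    by simp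
  moreover have "coprime (int l) (2 ^ 2)"
    using l by (simp only: coprime_power_right_iff) simp
  ultimately show ?thesis
    by (metis coprime_dvd_mult_right_iff)
qed

text \<open>Subtracting \<open>d\<close> from the index preserves divisibility: by
  \<open>lucas_U_add\<close>, \<open>l\<close> divides U_(d+1) U_(n-d), and by Cassini it cannot
  divide both U_d and U_(d+1).\<close>

lemma prime_dvd_lucas_U_mod:
  assumes l: "prime l" "\<not> l dvd Q" and d: "d > 0" "l dvd lucas_U P Q d" and n: "l dvd lucas_U P Q n"
  shows "l dvd lucas_U P Q (n mod d)"
  using n
proof (induction n rule: less_induct)
  case (less n)
  show ?case
  proof (cases "n < d")
    case True
    then show ?thesis
      using less.prems by simp
  next
    case False
    show ?thesis
    proof (cases "n = d")
      case False
      define j where "j = n - d - 1"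
      have n: "n = Suc (d + j)"
        using False \<open>\<not> n < d\<close> by (simp add: j_def)
      have "\<not> l dvd lucas_U P Q (Suc d)"
      proof
        assume "l dvd lucas_U P Q (Suc d)"
        then have "l dvd Q ^ d"
          using d lucas_U_cassini[of P Q d] by (simp add: power2_eq_square flip: lucas_U_cassini[of P Q d])
        then show False
          using l prime_dvd_power by blast
      qed
      moreover have "l dvd lucas_U P Q (Suc d) * lucas_U P Q (Suc j)"
      proof -
        have "lucas_U P Q (Suc d) * lucas_U P Q (Suc j) = lucas_U P Q n + Q * lucas_U P Q d * lucas_U P Q j"
          by (simp only: n lucas_U_add)
        then show ?thesis
          using less.prems d by simp
      qed
      ultimately have "l dvd lucas_U P Q (Suc j)"
        using l by (simp add: prime_dvd_mult_iff)
      then have "l dvd lucas_U P Q (Suc j mod d)"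
        using n d by (intro less.IH) auto
      then show ?thesis
        using n by (metis add_Suc_right mod_add_self1)
    qed simp
  qed
qed

lemma prime_index_dvd:
  assumes l: "prime l" "odd l" "\<not> int l dvd Q" and n: "prime n" "int l dvd lucas_U P Q n"
  shows "n dvd l * (l\<^sup>2 - 1)"
proof -
  have pr: "prime (int l)"
    using l by simp
  \<comment> \<open>The rank of apparition \<open>r\<close> divides both \<open>n\<close> and
    \<open>m\<close>. If the prime \<open>n\<close> did not divide \<open>m\<close>, then
    \<open>r\<close> would be 1, but U_1 = 1.\<close>
  have idx: "n dvd m" if "int l dvd lucas_U P Q m" for m
  proof (rule ccontr)
    assume "\<not> n dvd m"
    define r where "r = (LEAST r. r > 0 \<and> int l dvd lucas_U P Q r)"
    have r: "r > 0" "int l dvd lucas_U P Q r"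
      using LeastI[of "\<lambda>r. r > 0 \<and> int l dvd lucas_U P Q r" n] n
      by (auto simp: r_def prime_gt_0_nat)
    have "r dvd j" if "int l dvd lucas_U P Q j" for j
    proof (rule ccontr)
      assume "\<not> r dvd j"
      then have "j mod r > 0"
        by (simp add: mod_greater_zero_iff_not_dvd)
      then have "r \<le> j mod r"
        unfolding r_def using prime_dvd_lucas_U_mod[OF pr l(3) r that]
        by (intro Least_le) (simp add: r_def)
      then show False
        using mod_less_divisor[OF r(1), of j] by linarith
    qed
    then have "r dvd n" "r dvd m"
      using n that by auto
    then have "r = 1"
      using n \<open>\<not> n dvd m\<close> by (auto simp: prime_nat_iff)
    then show False
      using r pr by (simp add: prime_int_iff)
  qed
  have "(l - 1) * Suc l = l\<^sup>2 - 1"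
    by (cases l) (simp_all add: power2_eq_square)
  moreover have "n dvd l \<or> n dvd l - 1 \<or> n dvd Suc l"
    using prime_dvd_lucas_U_index[OF l(1,2), of P Q] l(3) pr idx by (auto simp: prime_dvd_mult_iff)
  ultimately show ?thesis
    by (metis dvd_mult dvd_mult2)
qed

section \<open>Hecke eigenforms\<close>

lemma exp_surj_unit_disc:
  assumes "w \<noteq> 0" "norm w < 1"
  obtains z where "z \<in> upper_half_plane" "exp (2 * of_real pi * \<i> * z) = w"
proof
  define z where "z = Ln w / (2 * of_real pi * \<i>)"
  show "exp (2 * of_real pi * \<i> * z) = w"
    using assms by (simp add: z_def exp_Ln)
  have "Im z = - Re (Ln w) / (2 * pi)"
    by (simp add: z_def Im_divide power2_eq_square)
  then show "z \<in> upper_half_plane"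
    using assms by (simp add: upper_half_plane_def divide_less_0_iff)
qed

text \<open>As q takes every value in the punctured unit disc, this is uniqueness of power series;
  \<open>c 0 = 0\<close> supplies the missing value at the centre.\<close>

lemma q_series_zero_imp_coeff_zero:
  assumes sums: "\<And>z. z \<in> upper_half_plane \<Longrightarrow> (\<lambda>n. c n * exp (2 * of_real pi * \<i> * z) ^ n) sums 0"
    and "c 0 = 0"
  shows "c n = 0"
proof (rule ccontr)
  assume n: "c n \<noteq> 0"
  have zero: "(\<lambda>n. c n * w ^ n) sums 0" if "norm w < 1" for w
  proof (cases "w = 0")
    case True
    then show ?thesis
      using \<open>c 0 = 0\<close> powser_sums_zero[of c] by simp
  next
    case False
    then show ?thesis
      using that sums exp_surj_unit_disc by metis
  qed
  have "n > 0"
    using n \<open>c 0 = 0\<close> by (auto intro: Nat.gr0I)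
  \<comment> \<open>A nonzero coefficient gives a punctured disc on which the sum has no zero; as
    the sum is 0, the absurd \<open>0 \<noteq> 0\<close> holds there.\<close>
  then obtain s :: real where s: "s > 0" "\<And>z::complex. z \<in> cball 0 s - {0} \<Longrightarrow> (0::complex) \<noteq> 0"
    using powser_0_nonzero[of 1 0 c "\<lambda>_. 0" n] zero n by (metis diff_zero zero_less_one)
  then show False
    using s(2)[of "of_real s"] by auto
qed

section \<open>Hecke operators at primes, acting on q-expansions\<close>

lemma sum_roots_of_unity_power:
  assumes "p > 0"
  shows "(\<Sum>b<p. exp (2 * of_real pi * \<i> * (of_nat b / of_nat p)) ^ n)
       = (if p dvd n then of_nat p else 0)"
proof -
  define \<zeta> where "\<zeta> = exp (2 * of_real pi * \<i> * (of_nat n / of_nat p))"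
  have "(\<Sum>b<p. exp (2 * of_real pi * \<i> * (of_nat b / of_nat p)) ^ n) = (\<Sum>b<p. \<zeta> ^ b)"
    by (intro sum.cong) (simp_all add: \<zeta>_def mult_ac flip: exp_of_nat_mult)
  moreover have "\<zeta> = 1 \<longleftrightarrow> p dvd n"
    using complex_root_unity_eq_1[of p n] assms by (simp add: \<zeta>_def mult_ac)
  moreover have "\<zeta> ^ p = 1"
    using assms complex_root_unity[of p n] by (simp add: \<zeta>_def mult_ac)
  ultimately show ?thesis
    by (auto simp: sum_gp_strict)
qed

lemma sums_dvd_reindex:
  fixes c :: "nat \<Rightarrow> complex"
  assumes "p > 0"
  shows "(\<lambda>n. (if p dvd n then c (n div p) else 0) * x ^ n) sums s \<longleftrightarrow> (\<lambda>n. c n * (x ^ p) ^ n) sums s"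
proof -
  have "strict_mono (\<lambda>n. p * n)"
    using assms by (simp add: strict_mono_def)
  moreover have "(if p dvd n then c (n div p) else 0) * x ^ n = 0" if "n \<notin> range ((*) p)" for n
    using that by auto
  ultimately have "(\<lambda>n. (if p dvd p * n then c (p * n div p) else 0) * x ^ (p * n)) sums s \<longleftrightarrow>
      (\<lambda>n. (if p dvd n then c (n div p) else 0) * x ^ n) sums s"
    by (rule sums_mono_reindex)
  then show ?thesis
    using assms by (simp add: power_mult)
qed

lemma hecke_operator_prime:
  assumes "prime p" "chi 1 = 1" "k > 0"
  shows "hecke_operator k chi p f z =
    chi (int p) * of_nat p ^ (k - 1) * f (of_nat p * z) + (\<Sum>b<p. f ((z + of_nat b) / of_nat p)) / of_nat p"
proof -
  have p: "{d. d dvd p} = {1, p}" "p \<noteq> 1" "p \<noteq> 0"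
    using assms by (auto simp: prime_nat_iff)
  have "(of_nat p :: complex) ^ k = of_nat p * of_nat p ^ (k - 1)"
    using assms by (cases k) auto
  with p show ?thesis
    using assms by (simp add: hecke_operator_def field_simps sum_distrib_left sum_divide_distrib)
qed

text \<open>Averaging over translates is the operator U_p: orthogonality of roots of unity removes
  all exponents not divisible by \<open>p\<close>.\<close>

lemma q_expansion_sum_translates:
  assumes f: "has_q_expansion f c" and z: "z \<in> upper_half_plane" and p: "p > 0"
  shows "(\<lambda>n. c (p * n) * exp (2 * of_real pi * \<i> * z) ^ n) sums
    ((\<Sum>b<p. f ((z + of_nat b) / of_nat p)) / of_nat p)"
proof -
  \<comment> \<open>A \<open>p\<close>-th root of q; translating by \<open>b\<close> multiplies it
    by the root of unity \<open>e b\<close>.\<close>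
  define x where "x = exp (2 * of_real pi * \<i> * (z / of_nat p))"
  define e where "e b = exp (2 * of_real pi * \<i> * (of_nat b / of_nat p))" for b
  have x: "x ^ p = exp (2 * of_real pi * \<i> * z)"
    using p by (simp add: x_def flip: exp_of_nat_mult)
  have "(\<lambda>n. c n * (x * e b) ^ n) sums f ((z + of_nat b) / of_nat p)" for b
  proof -
    have "(z + of_nat b) / of_nat p \<in> upper_half_plane"
      using z p by (simp add: upper_half_plane_def Im_divide_of_nat)
    moreover have "exp (2 * of_real pi * \<i> * ((z + of_nat b) / of_nat p)) = x * e b"
      by (simp add: x_def e_def add_divide_distrib ring_distribs exp_add)
    ultimately show ?thesis
      using f unfolding has_q_expansion_def by metis
  qed
  then have "(\<lambda>n. (\<Sum>b<p. c n * (x * e b) ^ n) / of_nat p) sums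
      ((\<Sum>b<p. f ((z + of_nat b) / of_nat p)) / of_nat p)"
    by (intro sums_divide sums_sum)
  moreover have "(\<Sum>b<p. c n * (x * e b) ^ n) / of_nat p =
      (if p dvd n then c (p * (n div p)) else 0) * x ^ n" for n
  proof -
    have "(\<Sum>b<p. c n * (x * e b) ^ n) = c n * x ^ n * (\<Sum>b<p. e b ^ n)"
      by (simp add: sum_distrib_left power_mult_distrib mult_ac)
    then show ?thesis
      using p sum_roots_of_unity_power[OF p, of n] by (simp only: e_def) simp
  qed
  ultimately show ?thesis
    using sums_dvd_reindex[OF p, of "\<lambda>n. c (p * n)"] by (simp add: x)
qed

lemma q_expansion_dilate:
  assumes f: "has_q_expansion f c" and z: "z \<in> upper_half_plane" and p: "p > 0"
  shows "(\<lambda>n. (if p dvd n then c (n div p) else 0) * exp (2 * of_real pi * \<i> * z) ^ n) sums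
    f (of_nat p * z)"
proof -
  have "of_nat p * z \<in> upper_half_plane"
    using z p by (simp add: upper_half_plane_def)
  then have "(\<lambda>n. c n * exp (2 * of_real pi * \<i> * (of_nat p * z)) ^ n) sums f (of_nat p * z)"
    using f by (simp add: has_q_expansion_def)
  moreover have "exp (2 * of_real pi * \<i> * (of_nat p * z)) = exp (2 * of_real pi * \<i> * z) ^ p"
    by (simp add: mult_ac flip: exp_of_nat_mult)
  ultimately show ?thesis
    using sums_dvd_reindex[OF p] by simp
qed

text \<open>Both sides of the eigenvalue equation are compared as q-series; the coefficient at 1,
  with \<open>c 1 = 1\<close>, identifies \<open>ev\<close> as \<open>c p\<close>.\<close>

lemma hecke_eigenform_coeff:
  assumes f: "has_q_expansion f c" and c: "c 0 = 0" "c 1 = 1"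
    and p: "prime p" and chi: "chi 1 = 1" and k: "k > 0"
    and ev: "\<And>z. z \<in> upper_half_plane \<Longrightarrow> hecke_operator k chi p f z = ev * f z"
  shows "c (p * n) + chi (int p) * of_nat p ^ (k - 1) * (if p dvd n then c (n div p) else 0) = c p * c n"
proof -
  have p0: "p > 0"
    using p by (simp add: prime_gt_0_nat)
  define t where "t n = c (p * n) + chi (int p) * of_nat p ^ (k - 1) * (if p dvd n then c (n div p) else 0)
      - ev * c n" for n
  have t: "t n = 0" for n
  proof (rule q_series_zero_imp_coeff_zero)
    fix z assume z: "z \<in> upper_half_plane"
    define q where "q = exp (2 * of_real pi * \<i> * z)"
    have "(\<lambda>n. c (p * n) * q ^ n
        + chi (int p) * of_nat p ^ (k - 1) * ((if p dvd n then c (n div p) else 0) * q ^ n)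
        - ev * (c n * q ^ n)) sums
       ((\<Sum>b<p. f ((z + of_nat b) / of_nat p)) / of_nat p
        + chi (int p) * of_nat p ^ (k - 1) * f (of_nat p * z) - ev * f z)"
      unfolding q_def using f z
      by (intro sums_add sums_diff sums_mult q_expansion_sum_translates[OF f z p0] q_expansion_dilate[OF f z p0])
         (simp add: has_q_expansion_def)
    also have "(\<Sum>b<p. f ((z + of_nat b) / of_nat p)) / of_nat p
        + chi (int p) * of_nat p ^ (k - 1) * f (of_nat p * z) - ev * f z = 0"
      using ev[OF z] hecke_operator_prime[of p chi k f z] p chi k by (simp add: add.commute)
    finally show "(\<lambda>n. t n * exp (2 * of_real pi * \<i> * z) ^ n) sums 0"
      by (simp add: t_def q_def algebra_simps)
  qed (simp add: t_def c)
  have "\<not> p dvd 1"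
    using p by (auto simp: prime_nat_iff)
  then have "ev = c p"
    using t[of 1] c by (simp add: t_def)
  then show ?thesis
    using t[of n] by (simp add: t_def)
qed

text \<open>Provides the integer sign that makes the Lucas parameter \<open>Q\<close> an integer
  although \<open>chi\<close> is complex-valued.\<close>

lemma quadratic_character_prime:
  assumes "quadratic_character N chi" "prime p" "\<not> p dvd N"
  obtains e :: int where "chi (int p) = of_int e" "\<bar>e\<bar> = 1"
proof -
  have "coprime (int p) (int N)"
    using assms by (simp add: prime_imp_coprime)
  then have "(chi (int p))\<^sup>2 = 1"
    using assms by (simp add: quadratic_character_def)
  then have "chi (int p) = of_int 1 \<or> chi (int p) = of_int (-1)"
    by (simp add: power2_eq_1_iff)
  then show ?thesis
    using that by (elim disjE) fastforce+
qed

text \<open>The index is shifted by one: \<open>a (p ^ e) = u\<^sub>e\<^sub>+\<^sub>1\<close>.\<close>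

lemma newform_coeff_prime_power:
  fixes a :: "nat \<Rightarrow> int"
  assumes k: "k \<ge> 3" and chi: "quadratic_character N chi" and new: "newform k N chi f"
    and f: "has_q_expansion f (\<lambda>n. of_int (a n))" and a: "a 0 = 0" "a 1 = 1"
    and p: "prime p" "\<not> p dvd N"
  obtains Q where "\<bar>Q\<bar> = int p ^ (k - 1)"
    "\<And>e m. \<not> p dvd m \<Longrightarrow> a (p ^ e * m) = lucas_U (a p) Q (Suc e) * a m"
proof -
  obtain s :: int where s: "chi (int p) = of_int s" "\<bar>s\<bar> = 1"
    using quadratic_character_prime[OF chi p] .
  define Q where "Q = s * int p ^ (k - 1)"
  have p0: "p > 0"
    using p by (simp add: prime_gt_0_nat)
  have chi1: "chi 1 = 1"
    using chi by (simp add: quadratic_character_def dirichlet_character_def)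
  obtain ev where ev: "\<And>z. z \<in> upper_half_plane \<Longrightarrow> hecke_operator k chi p f z = ev * f z"
    using new p0 unfolding newform_def by (metis One_nat_def Suc_leI)
  have rec: "a (p * n) + Q * (if p dvd n then a (n div p) else 0) = a p * a n" for n
  proof -
    have "(of_int (a (p * n) + Q * (if p dvd n then a (n div p) else 0)) :: complex) = of_int (a p * a n)"
      using hecke_eigenform_coeff[OF f _ _ p(1) chi1 _ ev, of n] k a by (auto simp: Q_def s)
    then show ?thesis
      by (simp only: of_int_eq_iff)
  qed
  have "a (p ^ e * m) = lucas_U (a p) Q (Suc e) * a m" if m: "\<not> p dvd m" for e m
  proof (induction e rule: induct_nat_012)
    case 1
    then show ?case
      using rec[of m] m by simp
  next
    case (ge2 e)
    have "a (p ^ Suc (Suc e) * m) = a p * a (p ^ Suc e * m) - Q * a (p ^ e * m)"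
      using rec[of "p ^ Suc e * m"] p0 by (simp add: mult.assoc)
    also have "\<dots> = lucas_U (a p) Q (Suc (Suc (Suc e))) * a m"
      unfolding ge2 by (simp add: algebra_simps)
    finally show ?case .
  qed simp
  moreover have "\<bar>Q\<bar> = int p ^ (k - 1)"
    by (simp add: Q_def abs_mult s)
  ultimately show ?thesis
    using that by blast
qed

section \<open>Unit and prime values among the coefficients of the newform\<close>

theorem theorem1p5:
  fixes k N :: nat and chi :: "int \<Rightarrow> complex" and f :: "complex \<Rightarrow> complex" and a :: "nat \<Rightarrow> int"
  assumes "k \<ge> 3" and "odd k" and "N \<ge> 1"
    and "quadratic_character N chi"
    and "newform k N chi f"
    and "has_q_expansion f (\<lambda>n. of_int (a n))" and "a 0 = 0" and "a 1 = 1"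
    and "trivial_residual_mod2 N a"
  shows
    "(\<forall>p d. prime p \<and> \<not> p dvd 2 * N \<and> d \<ge> 2 \<longrightarrow> a (p ^ (d - 1)) \<noteq> 1 \<and> a (p ^ (d - 1)) \<noteq> - 1) \<and>
     (\<forall>n. n > 1 \<and> gcd n (2 * N) = 1 \<longrightarrow> a n \<noteq> 1 \<and> a n \<noteq> - 1) \<and>
     (\<forall>n l. n > 1 \<and> gcd n (2 * N) = 1 \<and> prime l \<and> odd l \<and> (a n = int l \<or> a n = - int l) \<longrightarrow>
        (\<exists>p d. prime p \<and> odd d \<and> d dvd l * (l\<^sup>2 - 1) \<and> n = p ^ (d - 1) \<and>
           (\<forall>\<alpha> \<beta>. frobenius_roots k chi a p \<alpha> \<beta> \<and> \<not> defective \<alpha> \<beta> d \<longrightarrow> prime d \<and> odd d)))"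
proof -
  \<comment> \<open>The data at a good prime in the form the Lucas lemmas use:
    \<open>(k - 1) div 2\<close> is an exact half because \<open>k\<close> is odd, and
    \<open>p\<^sup>2\<close> divides \<open>Q\<close> because \<open>k \<ge> 3\<close>.\<close>
  have lucas: "\<exists>Q. \<bar>Q\<bar> = (int p ^ ((k - 1) div 2))\<^sup>2 \<and> (int p)\<^sup>2 dvd Q \<and> even (a p) \<and>
      (\<forall>q. prime q \<longrightarrow> q dvd Q \<longrightarrow> q = int p) \<and>
      (\<forall>e m. \<not> p dvd m \<longrightarrow> a (p ^ e * m) = lucas_U (a p) Q (Suc e) * a m)"
    if p: "prime p" "\<not> p dvd 2 * N" for p
  proof -
    have "\<not> p dvd N"
      using p by auto
    then obtain Q where Q: "\<bar>Q\<bar> = int p ^ (k - 1)"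
      "\<And>e m. \<not> p dvd m \<Longrightarrow> a (p ^ e * m) = lucas_U (a p) Q (Suc e) * a m"
      using newform_coeff_prime_power[OF assms(1,4-8) p(1)] by blast
    have "k - 1 = (k - 1) div 2 * 2"
      using \<open>odd k\<close> by simp
    then have "\<bar>Q\<bar> = (int p ^ ((k - 1) div 2))\<^sup>2"
      using Q(1) by (metis power_mult)
    moreover have "(int p)\<^sup>2 dvd Q"
      using \<open>k \<ge> 3\<close> le_imp_power_dvd[of 2 "k - 1" "int p"] unfolding Q(1) [symmetric] by simp
    moreover have "q = int p" if "prime q" "q dvd Q" for q
    proof -
      have "q dvd int p ^ (k - 1)"
        using that(2) by (metis Q(1) dvd_abs_iff)
      then have "q dvd int p"
        using that(1) prime_dvd_power by blast
      then show ?thesis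
        using that(1) p(1) by (simp add: primes_dvd_imp_eq)
    qed
    moreover have "even (a p)"
      using assms(9) p by (simp add: trivial_residual_mod2_def)
    ultimately show ?thesis
      using Q(2) by blast
  qed
  have big: "int p ^ ((k - 1) div 2) > 1" if "prime p" for p
    using that \<open>k \<ge> 3\<close> by (intro one_less_power) (auto simp: prime_gt_Suc_0_nat)
  have part1: "\<bar>a (p ^ e)\<bar> \<noteq> 1" if p: "prime p" "\<not> p dvd 2 * N" and e: "e > 0" for p e
  proof -
    obtain Q where Q: "\<bar>Q\<bar> = (int p ^ ((k - 1) div 2))\<^sup>2" "even (a p)"
      "\<And>e m. \<not> p dvd m \<Longrightarrow> a (p ^ e * m) = lucas_U (a p) Q (Suc e) * a m"
      using lucas[OF p] by blast
    have "\<not> p dvd 1"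
      using p by auto
    then have "a (p ^ e) = lucas_U (a p) Q (Suc e)"
      using Q(3)[of 1 e] \<open>a 1 = 1\<close> by simp
    then show ?thesis
      using abs_lucas_U_ne_1[OF Q(2,1) big[OF p(1)], of "Suc e"] e by simp
  qed
  have split: "\<exists>p e m. prime p \<and> \<not> p dvd 2 * N \<and> e > 0 \<and> \<not> p dvd m \<and> n = p ^ e * m \<and> m > 0 \<and>
      gcd m (2 * N) = 1 \<and> a n = a (p ^ e) * a m" if n: "n > 1" "gcd n (2 * N) = 1" for n
  proof -
    obtain p where p: "prime p" "p dvd n"
      using n prime_factor_nat[of n] by auto
    have "n \<noteq> 0" "\<not> is_unit p"
      using n p not_prime_unit by auto
    then obtain m where m: "n = p ^ multiplicity p n * m" "\<not> p dvd m"
      by (rule multiplicity_decompose')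
    have "multiplicity p n > 0"
      using p n by (simp add: prime_multiplicity_gt_zero_iff)
    moreover have pN: "\<not> p dvd 2 * N"
      using n p by (metis coprime_common_divisor coprime_iff_gcd_eq_1 not_prime_unit)
    moreover have "m dvd n"
      using m(1) by (metis dvd_triv_right)
    then have "gcd m (2 * N) = 1" "m > 0"
      using n coprime_divisors[of m n "2 * N" "2 * N"]
      by (auto simp: coprime_iff_gcd_eq_1 intro: Nat.gr0I)
    \<comment> \<open>Multiplicativity comes from the same formula, taken at the cofactor
      \<open>m\<close> and at 1.\<close>
    moreover have "a n = a (p ^ multiplicity p n) * a m"
    proof -
      obtain Q where Q: "\<And>e m. \<not> p dvd m \<Longrightarrow> a (p ^ e * m) = lucas_U (a p) Q (Suc e) * a m"
        using lucas[OF p(1) pN] by blast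
      have "\<not> p dvd 1"
        using p by auto
      then show ?thesis
        using Q[of 1 "multiplicity p n"] Q[OF m(2), of "multiplicity p n"] m(1) \<open>a 1 = 1\<close> by simp
    qed
    ultimately show ?thesis
      using p m by (intro exI[of _ p] exI[of _ "multiplicity p n"] exI[of _ m] conjI)
  qed
  \<comment> \<open>Splitting off one prime power suffices, as a factor of a unit is a unit.\<close>
  have part2: "\<bar>a n\<bar> \<noteq> 1" if n: "n > 1" "gcd n (2 * N) = 1" for n
  proof
    assume "\<bar>a n\<bar> = 1"
    moreover obtain p e m where "prime p" "\<not> p dvd 2 * N" "e > 0" "a n = a (p ^ e) * a m"
      using split[OF n] by blast
    ultimately show False
      using part1[of p e] by (metis abs_mult abs_zmult_eq_1)
  qed
  have part3: "\<exists>p d. prime p \<and> prime d \<and> odd d \<and> d dvd l * (l\<^sup>2 - 1) \<and> n = p ^ (d - 1)"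
    if n: "n > 1" "gcd n (2 * N) = 1" and l: "prime l" "odd l" and an: "\<bar>a n\<bar> = int l" for n l
  proof -
    obtain p e m where pem: "prime p" "\<not> p dvd 2 * N" "e > 0" "\<not> p dvd m" "n = p ^ e * m" "m > 0"
      "gcd m (2 * N) = 1" "a n = a (p ^ e) * a m"
      using split[OF n] by (elim exE conjE) (rule that)
    have "prime (int l)"
      using l by simp
    \<comment> \<open>One factor of a prime is a unit; \<open>part1\<close> leaves only
      \<open>a m\<close>, and then \<open>part2\<close> forces \<open>m = 1\<close>.\<close>
    then have "\<bar>a (p ^ e)\<bar> = 1 \<or> \<bar>a m\<bar> = 1"
      using irreducibleD[OF prime_elem_imp_irreducible[OF prime_imp_prime_elem], of "int l" "\<bar>a (p ^ e)\<bar>" "\<bar>a m\<bar>"]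
        an pem(8) by (metis abs_abs abs_mult zdvd1_eq)
    then have "\<bar>a m\<bar> = 1"
      using part1[OF pem(1-3)] by blast
    then have "m = 1"
      using part2[of m] pem(6,7) by linarith
    obtain Q where Q: "\<bar>Q\<bar> = (int p ^ ((k - 1) div 2))\<^sup>2" "even (a p)" "(int p)\<^sup>2 dvd Q"
      "\<And>q. prime q \<Longrightarrow> q dvd Q \<Longrightarrow> q = int p"
      "\<And>e m. \<not> p dvd m \<Longrightarrow> a (p ^ e * m) = lucas_U (a p) Q (Suc e) * a m"
      using lucas[OF pem(1,2)] by blast
    have U: "\<bar>lucas_U (a p) Q (Suc e)\<bar> = int l"
      using Q(5)[OF pem(4), of e] an pem(5) \<open>m = 1\<close> \<open>a 1 = 1\<close> by simp
    then have d: "prime (Suc e)"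
      using prime_index_lucas_U[OF Q(2,1) big[OF pem(1)]] l by simp
    have oddd: "odd (Suc e)"
    proof
      assume "even (Suc e)"
      then have "even \<bar>lucas_U (a p) Q (Suc e)\<bar>"
        using even_lucas_U[OF Q(2)] by simp
      then show False
        using U l by simp
    qed
    have lU: "int l dvd lucas_U (a p) Q (Suc e)"
      using U by (metis dvd_abs_iff dvd_refl)
    \<comment> \<open>Otherwise \<open>l = p\<close> divides \<open>a p\<close>, so
      \<open>l ^ e\<close> divides \<plusminus>l and \<open>e = 1\<close>, making the index 2, which
      is even.\<close>
    have "\<not> int l dvd Q"
    proof
      assume lQ: "int l dvd Q"
      then have lp: "l = p"
        using Q(4)[of "int l"] l by simp
      have "int l dvd a p ^ e"
        using lU lucas_U_cong_power[of "a p" Q e] lQ by (metis cong_dvd_iff cong_dvd_modulus)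
      then have "int l dvd a p"
        using l prime_dvd_power[of "int l"] by simp
      then have "int l ^ e dvd \<bar>lucas_U (a p) Q (Suc e)\<bar>"
        using power_dvd_lucas_U[of "int l" "a p" Q e] Q(3) lp by simp
      then have "int l ^ e \<le> int l ^ 1"
        using U l by (intro zdvd_imp_le) (auto simp: prime_gt_0_nat)
      then have "e \<le> 1"
        using l by (subst (asm) power_increasing_iff) (auto simp: prime_gt_Suc_0_nat)
      then show False
        using \<open>e > 0\<close> oddd by (cases "e = 1") auto
    qed
    then have "Suc e dvd l * (l\<^sup>2 - 1)"
      using prime_index_dvd[OF l _ d lU] by blast
    moreover have "n = p ^ (Suc e - 1)"
      using pem(5) \<open>m = 1\<close> by simp
    ultimately show ?thesis
      using pem(1) d oddd by blast
  qed
  show ?thesis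
  proof (intro conjI allI impI)
    fix p d :: nat
    assume "prime p \<and> \<not> p dvd 2 * N \<and> d \<ge> 2"
    then have "\<bar>a (p ^ (d - 1))\<bar> \<noteq> 1"
      by (intro part1) auto
    then show "a (p ^ (d - 1)) \<noteq> 1" "a (p ^ (d - 1)) \<noteq> - 1"
      by auto
  next
    fix n :: nat
    assume "n > 1 \<and> gcd n (2 * N) = 1"
    then have "\<bar>a n\<bar> \<noteq> 1"
      by (intro part2) auto
    then show "a n \<noteq> 1" "a n \<noteq> - 1"
      by auto
  next
    fix n l :: nat
    assume *: "n > 1 \<and> gcd n (2 * N) = 1 \<and> prime l \<and> odd l \<and> (a n = int l \<or> a n = - int l)"
    then have "\<bar>a n\<bar> = int l"
      by auto
    with * show "\<exists>p d. prime p \<and> odd d \<and> d dvd l * (l\<^sup>2 - 1) \<and> n = p ^ (d - 1) \<and>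
           (\<forall>\<alpha> \<beta>. frobenius_roots k chi a p \<alpha> \<beta> \<and> \<not> defective \<alpha> \<beta> d \<longrightarrow> prime d \<and> odd d)"
      using part3[of n l] by metis
  qed
qed

end
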